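(* \[m_{\mathbb{H}}(1+x+y)=\frac12-\frac{11\sqrt3}{16\pi}+\frac{3\sqrt3}{4\pi}L(\chi_{-3},2).\]
   Context: $\mathbb{H}$ denotes the quaternions, $\mathbb{T}^2(\mathbb{H})=\{(x,y)\in\mathbb{H}^2:|x|=|y|=1\}$ with probability Haar measure $\mu$ (product of normalized surface measures on $S^3$), and $m_{\mathbb{H}}(P)=\int_{\mathbb{T}^2(\mathbb{H})}\log|P(x,y)|\,d\mu$. $L(\chi_{-3},s)=\sum_{n\ge1}\chi_{-3}(n)n^{-s}$ where $\chi_{-3}$ is the odd Dirichlet character of conductor 3. *)

theory Defs
  imports "HOL-Probability.Probability"
begin

text \<open>Quaternions are modelled additively/metrically as \<open>complex \<times> complex\<close>
  (Cayley--Dickson: q = a + b j), with quaternion 1 = (1,0) and |q|^2 = |a|^2 + |b|^2,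
  which is exactly the product norm. Only addition and the norm of P(x,y)=1+x+y occur.\<close>

type_synonym quat = "complex \<times> complex"

definition quat_one :: quat where "quat_one = (1, 0)"

text \<open>Normalized surface (Haar) measure on S^3: the cone-measure construction,
  i.e. the push-forward of the uniform probability measure on the open unit ball
  of R^4 under radial projection x \<mapsto> x/|x|.\<close>

definition sphere3_measure :: "quat measure" where
  "sphere3_measure = distr (uniform_measure lborel (ball 0 1)) borel (\<lambda>x. x /\<^sub>R norm x)"

definition torus2H_measure :: "(quat \<times> quat) measure" where
  "torus2H_measure = sphere3_measure \<Otimes>\<^sub>M sphere3_measure"

definition mahler_H :: "(quat \<Rightarrow> quat \<Rightarrow> quat) \<Rightarrow> real" where
  "mahler_H P = (\<integral>z. ln (norm (P (fst z) (snd z))) \<partial>torus2H_measure)"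

definition chi_m3 :: "nat \<Rightarrow> real" where
  "chi_m3 n = (if n mod 3 = 1 then 1 else if n mod 3 = 2 then -1 else 0)"

definition L_chi_m3_2 :: real where
  "L_chi_m3_2 = (\<Sum>n. chi_m3 (Suc n) / (real (Suc n))^2)"

end

theory Submission
  imports Defs
begin

text \<open>For \<open>y\<close> uniform on \<open>S\<^sup>3\<close> and \<open>|v| = r\<close>, rotation invariance makes \<open>|v + y|\<^sup>2\<close> distributed as
  \<open>1 - 2 r cos \<theta> + r\<^sup>2\<close>, where \<open>\<theta>\<close> has density \<open>(2/\<pi>) sin\<^sup>2 \<theta>\<close> on \<open>[0, \<pi>]\<close>. Expanding the logarithm in
  \<open>r\<^sup>n cos (n \<theta>) / n\<close>, only \<open>n = 2\<close> survives against \<open>sin\<^sup>2 \<theta>\<close>, so the average of \<open>ln |v + y|\<close> is \<open>r\<^sup>2/4\<close>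
  for \<open>r < 1\<close>, and by scaling \<open>ln r + 1/(4 r\<^sup>2)\<close> for \<open>r > 1\<close>. Taking \<open>v = 1 + x\<close>, so \<open>r\<^sup>2 = 2 - 2 cos \<theta>\<close>, and
  averaging over \<open>x\<close> leaves elementary integrals and the integral of \<open>ln (2 - 2 cos \<theta>) / 2\<close> over
  \<open>[\<pi>/3, \<pi>]\<close>, which by Abel summation is \<open>\<Sum> sin (n \<pi>/3) / n\<^sup>2\<close>, a multiple of \<open>L(\<chi>\<^sub>-\<^sub>3, 2)\<close>.\<close>

section \<open>Rotation invariance and marginals of the uniform measure on the 3-sphere\<close>

lemma nn_integral_lborel_shift:
  fixes f :: "'a::euclidean_space \<Rightarrow> ennreal"
  assumes [measurable]: "f \<in> borel_measurable borel"
  shows "(\<integral>\<^sup>+x. f (c + x) \<partial>lborel) = (\<integral>\<^sup>+x. f x \<partial>lborel)"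
  by (subst (2) lborel_distr_plus[symmetric, of c]) (simp add: nn_integral_distr)

lemma nn_integral_lborel_scale:
  fixes f :: "'a::euclidean_space \<Rightarrow> ennreal"
  assumes [measurable]: "f \<in> borel_measurable borel" and "c \<noteq> 0"
  shows "(\<integral>\<^sup>+x. f x \<partial>lborel) = ennreal (\<bar>c\<bar> ^ DIM('a)) * (\<integral>\<^sup>+x. f (c *\<^sub>R x) \<partial>lborel)"
  by (subst lborel_affine[OF assms(2), of 0])
     (simp add: nn_integral_density nn_integral_distr nn_integral_cmult)

text \<open>Evaluate the integral of \<open>1\<^sub>A(x) 1\<^sub>B(x + y)\<close>, \<open>B\<close> the unit ball, against \<open>M \<Otimes> lborel\<close> in both orders.\<close>

lemma translation_invariant_eq_lborel:
  fixes M :: "'a::euclidean_space measure"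
  assumes sets_M[measurable_cong]: "sets M = sets borel"
    and "sigma_finite_measure M"
    and inv: "\<And>c. distr M borel ((+) c) = M"
    and ball: "emeasure M (ball 0 1) = emeasure lborel (ball 0 1 :: 'a set)"
  shows "M = lborel"
proof (rule measure_eqI)
  interpret M: sigma_finite_measure M by fact
  interpret pair_sigma_finite M "lborel :: 'a measure" ..
  fix A assume "A \<in> sets M"
  then have [measurable]: "A \<in> sets borel" by (simp add: sets_M)
  define B :: "'a set" where "B = ball 0 1"
  have [measurable]: "B \<in> sets borel" by (simp add: B_def)
  let ?f = "\<lambda>x y. indicator A x * indicator B (x + y) :: ennreal"
  have "(\<integral>\<^sup>+x. \<integral>\<^sup>+y. ?f x y \<partial>lborel \<partial>M) = emeasure M A * emeasure lborel B"
  proof -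
    have "(\<integral>\<^sup>+y. ?f x y \<partial>lborel) = indicator A x * emeasure lborel B" for x
      by (simp add: nn_integral_cmult nn_integral_lborel_shift[of "indicator B"])
    then show ?thesis by (simp add: nn_integral_multc)
  qed
  moreover have "(\<integral>\<^sup>+y. \<integral>\<^sup>+x. ?f x y \<partial>M \<partial>lborel) = emeasure lborel A * emeasure M B"
  proof -
    \<comment> \<open>Invariance of \<open>M\<close> under translation by \<open>-y\<close> moves
      the shift from the ball to \<open>A\<close>.\<close>
    have "(\<integral>\<^sup>+x. ?f x y \<partial>M) = (\<integral>\<^sup>+x. indicator A (x - y) * indicator B x \<partial>M)" for y
      by (subst inv[symmetric, of "-y"]) (simp add: nn_integral_distr)
    then have "(\<integral>\<^sup>+y. \<integral>\<^sup>+x. ?f x y \<partial>M \<partial>lborel)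
        = (\<integral>\<^sup>+y. \<integral>\<^sup>+x. indicator A (x - y) * indicator B x \<partial>M \<partial>lborel)" by simp
    also have "\<dots> = (\<integral>\<^sup>+x. \<integral>\<^sup>+y. indicator A (x - y) * indicator B x \<partial>lborel \<partial>M)"
      by (rule Fubini') simp
    also have "\<dots> = (\<integral>\<^sup>+x. emeasure lborel A * indicator B x \<partial>M)"
    proof (rule nn_integral_cong)
      fix x :: 'a
      have "(\<integral>\<^sup>+y. indicator A (x - y) \<partial>lborel) = (\<integral>\<^sup>+y. indicator A (x + y) \<partial>lborel)"
        by (subst nn_integral_lborel_scale[of _ "-1"]) simp_all
      then show "(\<integral>\<^sup>+y. indicator A (x - y) * indicator B x \<partial>lborel) = emeasure lborel A * indicator B x"
        by (simp add: nn_integral_multc nn_integral_lborel_shift[of "indicator A"])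
    qed
    finally show ?thesis by (simp add: nn_integral_cmult)
  qed
  moreover have "(\<integral>\<^sup>+y. \<integral>\<^sup>+x. ?f x y \<partial>M \<partial>lborel) = (\<integral>\<^sup>+x. \<integral>\<^sup>+y. ?f x y \<partial>lborel \<partial>M)"
    by (rule Fubini') simp
  ultimately have "emeasure M A * emeasure lborel B = emeasure lborel A * emeasure lborel B"
    by (simp add: ball B_def)
  \<comment> \<open>The ball has positive finite volume, so it can be cancelled in
    \<open>ennreal\<close>.\<close>
  moreover have "emeasure lborel B \<noteq> 0" "emeasure lborel B \<noteq> \<infinity>"
    by (simp_all add: emeasure_ball B_def less_imp_neq[OF unit_ball_vol_pos, symmetric])
  ultimately show "emeasure M A = emeasure lborel A"
    by (metis ennreal_mult_cancel_left infinity_ennreal_def mult.commute)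
qed (simp add: sets_M)

text \<open>Translation by \<open>c = T d\<close> after \<open>T\<close> is \<open>T\<close> after
  translation by \<open>d\<close>, so the image measure is again translation invariant. Since
  \<open>T\<close> preserves norms, the unit ball keeps its volume, and the characterization above
  applies.\<close>

lemma distr_lborel_orthogonal_transformation:
  fixes T :: "'a::euclidean_space \<Rightarrow> 'a"
  assumes T: "orthogonal_transformation T"
  shows "distr lborel borel T = lborel"
proof (rule translation_invariant_eq_lborel)
  have lin: "linear T" using T by (rule orthogonal_transformation_linear)
  then have [measurable]: "T \<in> borel_measurable borel"
    by (intro borel_measurable_continuous_onI linear_continuous_on linear_conv_bounded_linear[THEN iffD1])
  have nrm: "norm (T x) = norm x" for x using T by (rule orthogonal_transformation_norm)
  have vim: "T -` ball 0 r = ball 0 r" for r by (auto simp: nrm)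
  show "sigma_finite_measure (distr lborel borel T)"
  proof (unfold_locales, intro exI conjI)
    let ?A = "range (\<lambda>n::nat. ball 0 (real n) :: 'a set)"
    show "countable ?A" by simp
    show "?A \<subseteq> sets (distr lborel borel T)" by auto
    show "\<Union> ?A = space (distr lborel borel T)"
      by (auto intro: reals_Archimedean2)
    show "\<forall>a\<in>?A. emeasure (distr lborel borel T) a \<noteq> \<infinity>"
      by (auto simp: emeasure_distr vim emeasure_ball)
  qed
  show "emeasure (distr lborel borel T) (ball 0 1) = emeasure lborel (ball 0 1 :: 'a set)"
    by (simp add: emeasure_distr vim)
  fix c
  obtain d where d: "c = T d" using orthogonal_transformation_surj[OF T] by (metis surjD)
  have "distr (distr lborel borel T) borel ((+) c) = distr lborel borel (\<lambda>x. T (d + x))"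
    by (subst distr_distr) (simp_all add: o_def d linear_add[OF lin])
  also have "\<dots> = distr (distr lborel borel ((+) d)) borel T"
    by (subst distr_distr) (simp_all add: o_def)
  finally show "distr (distr lborel borel T) borel ((+) c) = distr lborel borel T"
    by (simp add: lborel_distr_plus)
qed simp

text \<open>Radial projection commutes with \<open>T\<close>, which is linear and norm preserving,
  and the uniform measure on the ball is itself \<open>T\<close>-invariant.\<close>

lemma distr_sphere3_orthogonal_transformation:
  assumes T: "orthogonal_transformation T"
  shows "distr sphere3_measure borel T = sphere3_measure"
proof -
  have lin: "linear T" using T by (rule orthogonal_transformation_linear)
  then have [measurable]: "T \<in> borel_measurable borel"
    by (intro borel_measurable_continuous_onI linear_continuous_on linear_conv_bounded_linear[THEN iffD1])
  have nrm: "norm (T x) = norm x" for x using T by (rule orthogonal_transformation_norm)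
  have u: "distr (uniform_measure lborel (ball 0 1)) borel T = uniform_measure lborel (ball 0 1)"
  proof (rule measure_eqI)
    fix A assume "A \<in> sets (distr (uniform_measure lborel (ball 0 1)) borel T)"
    then have [measurable]: "A \<in> sets borel" by simp
    have m: "T -` A \<in> sets borel"
      using measurable_sets[of T borel borel A] by simp
    have "ball 0 1 \<inter> T -` A = T -` (ball 0 1 \<inter> A)"
      by (rule set_eqI) (simp add: nrm)
    moreover have "emeasure lborel (T -` (ball 0 1 \<inter> A)) = emeasure (distr lborel borel T) (ball 0 1 \<inter> A)"
      by (subst emeasure_distr) simp_all
    ultimately show "emeasure (distr (uniform_measure lborel (ball 0 1)) borel T) A
        = emeasure (uniform_measure lborel (ball 0 1)) A"
      using m by (simp add: emeasure_distr distr_lborel_orthogonal_transformation[OF T])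
  qed simp
  have "distr sphere3_measure borel T
      = distr (uniform_measure lborel (ball 0 1)) borel (\<lambda>x. T x /\<^sub>R norm (T x))"
    unfolding sphere3_measure_def
    by (subst distr_distr) (simp_all add: o_def nrm linear_scale[OF lin])
  also have "\<dots> = distr (distr (uniform_measure lborel (ball 0 1)) borel T) borel (\<lambda>x. x /\<^sub>R norm x)"
    by (subst distr_distr) (simp_all add: o_def)
  finally show ?thesis by (simp add: u sphere3_measure_def)
qed

section \<open>Marginals: one complex coordinate, then one real coordinate\<close>

text \<open>The disc of radius \<open>sqrt x\<close> has area \<open>pi * x\<close>, which is linear
  in \<open>x\<close>, so the squared radius has constant density. Half-lines generate the Borel
  sets and suffice for the comparison.\<close>

lemma distr_lborel_norm_sq_complex:
  "distr (lborel :: complex measure) borel (\<lambda>b. (norm b)\<^sup>2)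
    = density lborel (\<lambda>s. ennreal pi * indicator {0..} s)"
proof (rule measure_eqI_generator_eq)
  let ?E = "range (\<lambda>x::real. {..x})"
  show "Int_stable ?E" by (auto simp: Int_stable_def)
  show "?E \<subseteq> Pow UNIV" by simp
  show "sets (distr (lborel :: complex measure) borel (\<lambda>b. (norm b)\<^sup>2)) = sigma_sets UNIV ?E"
     "sets (density lborel (\<lambda>s. ennreal pi * indicator {0..} s)) = sigma_sets UNIV ?E"
    by (simp_all add: borel_eq_atMost)
  show "range (\<lambda>n::nat. {..real n}) \<subseteq> ?E" by auto
  show "(\<Union>n. {..real n}) = UNIV" by (auto intro: real_arch_simple)
  have 1: "emeasure (distr (lborel :: complex measure) borel (\<lambda>b. (norm b)\<^sup>2)) {..x} = ennreal (pi * max 0 x)" for x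
  proof (cases "x \<ge> 0")
    case True
    then have "(\<lambda>b::complex. (norm b)\<^sup>2) -` {..x} = cball 0 (sqrt x)"
      by (auto simp: real_le_rsqrt) (metis real_sqrt_pow2 norm_ge_zero power_mono)
    then show ?thesis using True
      by (simp add: emeasure_distr emeasure_cball unit_ball_vol_2)
  next
    case False
    then have "(\<lambda>b::complex. (norm b)\<^sup>2) -` {..x} = {}"
      by (auto simp: not_le) (meson dual_order.strict_trans2 not_le zero_le_power2)
    then show ?thesis using False by (simp add: emeasure_distr)
  qed
  then show "emeasure (distr (lborel :: complex measure) borel (\<lambda>b. (norm b)\<^sup>2)) {..real i} \<noteq> \<infinity>" for i by simp
  fix X assume "X \<in> ?E"
  then obtain x where X: "X = {..x}" by auto
  have "emeasure (density lborel (\<lambda>s. ennreal pi * indicator {0..} s)) {..x}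
      = (\<integral>\<^sup>+s. ennreal pi * indicator {0..x} s \<partial>lborel)"
    by (subst emeasure_density) (auto intro!: nn_integral_cong simp: indicator_def)
  also have "\<dots> = ennreal (pi * max 0 x)"
    by (cases "x \<ge> 0") (simp_all add: nn_integral_cmult ennreal_mult)
  finally show "emeasure (distr (lborel :: complex measure) borel (\<lambda>b. (norm b)\<^sup>2)) X
      = emeasure (density lborel (\<lambda>s. ennreal pi * indicator {0..} s)) X"
    by (simp add: 1 X)
qed

lemma borel_measurable_fst_snd_borel [measurable]:
  shows "fst \<in> borel_measurable (borel :: ('a::second_countable_topology \<times> 'b::second_countable_topology) measure)"
    and "snd \<in> borel_measurable (borel :: ('a::second_countable_topology \<times> 'b::second_countable_topology) measure)"
  unfolding borel_prod[symmetric] by simp_all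

text \<open>The Archimedes--Hopf principle: one complex coordinate of a uniform point of \<open>S\<^sup>3\<close>
  is uniform in the disc. With \<open>t = |a|\<^sup>2 + |b|\<^sup>2\<close>, the slice of the ball at fixed \<open>t\<close>
  is a disc of radius \<open>\<surd>t\<close> in the variable \<open>a\<close>.\<close>

lemma nn_integral_sphere3_fst:
  assumes [measurable]: "f \<in> borel_measurable borel"
  shows "(\<integral>\<^sup>+y. f (fst y) \<partial>sphere3_measure)
    = (\<integral>\<^sup>+a. f a * indicator (cball 0 1) a \<partial>lborel) / ennreal pi"
proof -
  have [measurable]: "(ball 0 1 :: quat set) \<in> sets borel" "(cball 0 1 :: complex set) \<in> sets borel"
    by simp_all
  define K where "K = (\<integral>\<^sup>+a. f a * indicator (cball 0 1) a \<partial>lborel)"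
  have nb: "norm (a, b) = sqrt ((norm a)\<^sup>2 + (norm b)\<^sup>2)" for a b :: complex
    by (simp add: norm_Pair)
  have ib: "indicator (ball 0 1) (a, b) = (indicator {..<1} ((norm a)\<^sup>2 + (norm b)\<^sup>2) :: ennreal)" for a b :: complex
    by (simp add: indicator_def nb)
  have "(\<integral>\<^sup>+x. f (fst (x /\<^sub>R norm x)) * indicator (ball 0 1) x \<partial>(lborel :: quat measure))
     = (\<integral>\<^sup>+a. \<integral>\<^sup>+b. f (a /\<^sub>R sqrt ((norm a)\<^sup>2 + (norm b)\<^sup>2)) * indicator {..<1} ((norm a)\<^sup>2 + (norm b)\<^sup>2) \<partial>(lborel::complex measure) \<partial>lborel)"
  proof -
    have m: "(\<lambda>x. f (fst (x /\<^sub>R norm x)) * indicator (ball 0 1) x) \<in> borel_measurable ((lborel :: complex measure) \<Otimes>\<^sub>M (lborel :: complex measure))"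
      unfolding lborel_prod by simp
    from lborel.nn_integral_fst[OF m] show ?thesis
      unfolding lborel_prod by (simp add: nb ib)
  qed
  also have "\<dots> = (\<integral>\<^sup>+a. \<integral>\<^sup>+t. ennreal pi * indicator {(norm a)\<^sup>2..} t * (f (a /\<^sub>R sqrt t) * indicator {..<1} t) \<partial>lborel \<partial>lborel)"
  proof (rule nn_integral_cong)
    fix a :: complex
    have "(\<integral>\<^sup>+b. f (a /\<^sub>R sqrt ((norm a)\<^sup>2 + (norm b)\<^sup>2)) * indicator {..<1} ((norm a)\<^sup>2 + (norm b)\<^sup>2) \<partial>(lborel :: complex measure))
      = (\<integral>\<^sup>+s. f (a /\<^sub>R sqrt ((norm a)\<^sup>2 + s)) * indicator {..<1} ((norm a)\<^sup>2 + s) \<partial>(distr (lborel :: complex measure) borel (\<lambda>b. (norm b)\<^sup>2)))"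
      by (subst nn_integral_distr) simp_all
    \<comment> \<open>The condition \<open>0 \<le> s\<close> is rewritten in terms of the sum of
      \<open>s\<close> and the squared norm of \<open>a\<close>, so that the whole integrand is
      ready for the shift to \<open>t\<close>.\<close>
    also have "\<dots> = (\<integral>\<^sup>+s. ennreal pi * indicator {(norm a)\<^sup>2..} ((norm a)\<^sup>2 + s) * (f (a /\<^sub>R sqrt ((norm a)\<^sup>2 + s)) * indicator {..<1} ((norm a)\<^sup>2 + s)) \<partial>lborel)"
      unfolding distr_lborel_norm_sq_complex
      by (subst nn_integral_density) (auto intro!: nn_integral_cong simp: indicator_def)
    also have "\<dots> = (\<integral>\<^sup>+t. ennreal pi * indicator {(norm a)\<^sup>2..} t * (f (a /\<^sub>R sqrt t) * indicator {..<1} t) \<partial>lborel)"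
      by (rule nn_integral_lborel_shift) simp
    finally show "(\<integral>\<^sup>+b. f (a /\<^sub>R sqrt ((norm a)\<^sup>2 + (norm b)\<^sup>2)) * indicator {..<1} ((norm a)\<^sup>2 + (norm b)\<^sup>2) \<partial>(lborel :: complex measure)) = \<dots>" .
  qed
  also have "\<dots> = (\<integral>\<^sup>+t. \<integral>\<^sup>+a. ennreal pi * indicator {(norm a)\<^sup>2..} t * (f (a /\<^sub>R sqrt t) * indicator {..<1} t) \<partial>lborel \<partial>lborel)"
    by (rule lborel_pair.Fubini') (simp add: indicator_def)
  also have "\<dots> = (\<integral>\<^sup>+t. ennreal t * indicator {0..1} t * (ennreal pi * K) \<partial>lborel)"
  proof (rule nn_integral_cong_AE)
    \<comment> \<open>At \<open>t = 1\<close> the half-open and closed indicators differ, and at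
      \<open>t = 0\<close> the scaling by \<open>sqrt t\<close> degenerates.\<close>
    have "AE t in lborel. t \<noteq> (0::real)" "AE t in lborel. t \<noteq> (1::real)"
      by (rule AE_lborel_singleton)+
    then show "AE t in lborel. (\<integral>\<^sup>+a. ennreal pi * indicator {(norm a)\<^sup>2..} t * (f (a /\<^sub>R sqrt t) * indicator {..<1} t) \<partial>(lborel::complex measure))
       = ennreal t * indicator {0..1} t * (ennreal pi * K)"
    proof eventually_elim
      case (elim t)
      consider "t < 0" | "t > 1" | "0 < t" "t < 1" using elim by linarith
      then show ?case
      proof cases
        case 1
        then have "\<not> (norm a)\<^sup>2 \<le> t" for a :: complex
          by (meson dual_order.strict_trans2 not_le zero_le_power2)
        with 1 show ?thesis by simp
      next
        case 3
        have ind: "indicator {(norm a)\<^sup>2..} t = (indicator {..t} ((norm a)\<^sup>2) :: ennreal)" for a :: complex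
          by (simp add: indicator_def)
        have i: "indicator {..t} ((sqrt t * norm w)\<^sup>2) = (indicator (cball 0 1) w :: ennreal)" for w :: complex
          using 3 by (simp add: indicator_def power_mult_distrib abs_square_le_1)
        \<comment> \<open>Substituting \<open>sqrt t *\<^sub>R w\<close> for \<open>a\<close> turns
          the disc of radius \<open>sqrt t\<close> into the unit disc; real dimension 2 gives the
          Jacobian \<open>t\<close>.\<close>
        have "(\<integral>\<^sup>+a. ennreal pi * indicator {(norm a)\<^sup>2..} t * (f (a /\<^sub>R sqrt t) * indicator {..<1} t) \<partial>(lborel::complex measure))
          = ennreal t * (\<integral>\<^sup>+w. ennreal pi * (f w * indicator (cball 0 1) w) \<partial>(lborel::complex measure))"
          using 3 unfolding ind by (subst nn_integral_lborel_scale[of _ "sqrt t"]) (simp_all add: i ac_simps)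
        then show ?thesis using 3 by (simp add: K_def nn_integral_cmult)
      qed simp
    qed
  qed
  also have "\<dots> = ennreal (1/2 * pi) * K"
  proof -
    have "(\<integral>\<^sup>+t. ennreal t * indicator {0..1} t \<partial>lborel) = ennreal (1/2)"
      by (subst nn_integral_FTC_Icc[where F="\<lambda>t. t^2/2"]) (auto intro!: derivative_eq_intros)
    then have "(\<integral>\<^sup>+t. ennreal t * indicator {0..1} t * (ennreal pi * K) \<partial>lborel)
        = ennreal (1/2) * (ennreal pi * K)"
      by (subst nn_integral_multc) simp_all
    also have "\<dots> = ennreal (1/2 * pi) * K"
      unfolding mult.assoc[symmetric] by (subst ennreal_mult[symmetric]) simp_all
    finally show ?thesis .
  qed
  finally have *: "(\<integral>\<^sup>+x. f (fst (x /\<^sub>R norm x)) * indicator (ball 0 1) x \<partial>(lborel :: quat measure))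
      = ennreal (pi/2) * K" by simp
  have "(\<integral>\<^sup>+y. f (fst y) \<partial>sphere3_measure)
     = (\<integral>\<^sup>+x. f (fst (x /\<^sub>R norm x)) \<partial>(uniform_measure lborel (ball 0 1) :: quat measure))"
    unfolding sphere3_measure_def by (subst nn_integral_distr) simp_all
  also have "\<dots> = (\<integral>\<^sup>+x. f (fst (x /\<^sub>R norm x)) * indicator (ball 0 1) x \<partial>(lborel :: quat measure)) / emeasure lborel (ball 0 1 :: quat set)"
    by (rule nn_integral_uniform_measure) simp_all
  \<comment> \<open>The unit ball of real dimension 4 has volume
    \<open>pi\<^sup>2 / 2\<close>.\<close>
  also have "\<dots> = ennreal (pi/2) * K / ennreal (pi\<^sup>2 / 2)"
    unfolding * by (simp add: emeasure_ball unit_ball_vol_4)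
  also have "\<dots> = K / ennreal pi"
  proof -
    have "ennreal (pi\<^sup>2/2) = ennreal (pi/2) * ennreal pi"
      by (subst ennreal_mult[symmetric]) (simp_all add: power2_eq_square)
    then show ?thesis
      using divide_mult_eq[of "ennreal (pi/2)" K "ennreal pi"] by (simp add: mult.commute)
  qed
  finally show ?thesis by (simp add: K_def)
qed

text \<open>Makes Fubini in the real and imaginary parts available on the complex plane; it suffices
  that boxes pull back to rectangles of the same area.\<close>

lemma lborel_complex_eq:
  "lborel = distr (lborel \<Otimes>\<^sub>M lborel) borel (\<lambda>(x, y). Complex x y)"
proof (rule lborel_eqI)
  have [measurable]: "(\<lambda>(x, y). Complex x y) \<in> borel_measurable (lborel \<Otimes>\<^sub>M lborel)"
    unfolding lborel_prod
    by (auto intro!: borel_measurable_continuous_onI continuous_intros simp: Complex_eq case_prod_beta)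
  fix l u :: complex assume le: "\<And>b. b \<in> Basis \<Longrightarrow> l \<bullet> b \<le> u \<bullet> b"
  have le': "Re l \<le> Re u" "Im l \<le> Im u" using le[of 1] le[of \<i>] by (simp_all add: Basis_complex_def)
  have "(\<lambda>(x, y). Complex x y) -` box l u = box (Re l) (Re u) \<times> box (Im l) (Im u)"
    by (auto simp: box_def Basis_complex_def)
  then have "emeasure (distr (lborel \<Otimes>\<^sub>M lborel) borel (\<lambda>(x, y). Complex x y)) (box l u)
      = emeasure (lborel \<Otimes>\<^sub>M lborel) (box (Re l) (Re u) \<times> box (Im l) (Im u))"
    by (simp add: emeasure_distr space_pair_measure)
  also have "\<dots> = ennreal ((Re u - Re l) * (Im u - Im l))"
    using le' by (subst lborel.emeasure_pair_measure_Times) (auto simp: ennreal_mult)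
  finally show "emeasure (distr (lborel \<Otimes>\<^sub>M lborel) borel (\<lambda>(x, y). Complex x y)) (box l u)
      = ennreal (\<Prod>b\<in>Basis. (u - l) \<bullet> b)"
    by (simp add: Basis_complex_def)
qed simp

text \<open>The law of the angle between a uniform point of \<open>S\<^sup>3\<close> and a fixed axis.\<close>

definition zonal_measure :: "real measure" where
  "zonal_measure = density lborel (\<lambda>\<theta>. ennreal (2 / pi * (sin \<theta>)\<^sup>2) * indicator {0..pi} \<theta>)"

lemma sets_zonal_measure [measurable_cong, simp]: "sets zonal_measure = sets borel"
  by (simp add: zonal_measure_def)

lemma space_zonal_measure [simp]: "space zonal_measure = UNIV"
  by (simp add: zonal_measure_def)

text \<open>The chord of the unit disc over \<open>x\<close> has length
  \<open>2 * sqrt (1 - x\<^sup>2)\<close>. With \<open>x = - cos \<theta>\<close> this becomes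
  \<open>2 * sin \<theta>\<close>, and \<open>dx\<close> contributes another
  \<open>sin \<theta>\<close>. The minus sign makes the substitution increasing on
  \<open>{0..pi}\<close>.\<close>

lemma nn_integral_disc_Re:
  assumes [measurable]: "f \<in> borel_measurable borel"
  shows "(\<integral>\<^sup>+a. f (Re a) * indicator (cball 0 1) a \<partial>lborel) / ennreal pi
    = (\<integral>\<^sup>+\<theta>. f (- cos \<theta>) \<partial>zonal_measure)"
proof -
  have m [measurable]: "(\<lambda>z. Complex (fst z) (snd z)) \<in> borel_measurable (lborel \<Otimes>\<^sub>M lborel)"
    unfolding lborel_prod
    by (auto intro!: borel_measurable_continuous_onI continuous_intros simp: Complex_eq)
  have [measurable]: "(cball 0 1 :: complex set) \<in> sets borel" by simp
  let ?h = "\<lambda>x. f x * ennreal (2 * sqrt (1 - x\<^sup>2))"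
  have "(\<integral>\<^sup>+a. f (Re a) * indicator (cball 0 1) a \<partial>lborel)
      = (\<integral>\<^sup>+x. \<integral>\<^sup>+y. f x * indicator (cball 0 1) (Complex x y) \<partial>lborel \<partial>lborel)"
  proof -
    have "(\<lambda>z. f (fst z) * indicator (cball 0 1) (Complex (fst z) (snd z))) \<in> borel_measurable (lborel \<Otimes>\<^sub>M lborel)"
      by measurable
    from lborel.nn_integral_fst[OF this] show ?thesis
      by (subst lborel_complex_eq) (simp add: nn_integral_distr case_prod_beta m)
  qed
  also have "\<dots> = (\<integral>\<^sup>+x. ?h x * indicator {- cos 0..- cos pi} x \<partial>lborel)"
  proof (rule nn_integral_cong)
    fix x :: real
    have "(\<integral>\<^sup>+y. f x * indicator (cball 0 1) (Complex x y) \<partial>lborel)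
        = (\<integral>\<^sup>+y. f x * (indicator {- sqrt (1 - x\<^sup>2)..sqrt (1 - x\<^sup>2)} y * indicator {-1..1} x) \<partial>lborel)"
    proof (intro nn_integral_cong arg_cong[where f="(*) (f x)"])
      fix y :: real
      have "x\<^sup>2 + y\<^sup>2 \<le> 1 \<longleftrightarrow> y \<in> {- sqrt (1 - x\<^sup>2)..sqrt (1 - x\<^sup>2)} \<and> x \<in> {-1..1}"
      proof -
        \<comment> \<open>\<open>sqrt\<close> is monotone on all reals, with negative values at
          negative arguments, so this also covers \<open>x\<^sup>2 > 1\<close>, where both sides are
          false.\<close>
        have "\<bar>y\<bar> \<le> sqrt (1 - x\<^sup>2) \<longleftrightarrow> y\<^sup>2 \<le> 1 - x\<^sup>2"
          using real_sqrt_le_iff[of "y\<^sup>2" "1 - x\<^sup>2"] by simp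
        moreover have "\<bar>x\<bar> \<le> 1 \<longleftrightarrow> x\<^sup>2 \<le> 1" by (rule abs_square_le_1[symmetric])
        moreover have "0 \<le> y\<^sup>2" by simp
        moreover have "y \<in> {- sqrt (1 - x\<^sup>2)..sqrt (1 - x\<^sup>2)} \<longleftrightarrow> \<bar>y\<bar> \<le> sqrt (1 - x\<^sup>2)"
          "x \<in> {-1..1} \<longleftrightarrow> \<bar>x\<bar> \<le> 1" by auto
        ultimately show ?thesis by linarith
      qed
      then show "indicator (cball 0 1) (Complex x y)
          = (indicator {- sqrt (1 - x\<^sup>2)..sqrt (1 - x\<^sup>2)} y * indicator {-1..1} x :: ennreal)"
        by (simp add: indicator_def cmod_def)
    qed
    also have "\<dots> = ?h x * indicator {- cos 0..- cos pi} x"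
    proof (cases "x \<in> {-1..1}")
      case True
      then have "x\<^sup>2 \<le> 1" by (simp add: abs_square_le_1 abs_le_iff)
      then have "- sqrt (1 - x\<^sup>2) \<le> sqrt (1 - x\<^sup>2)" by simp
      from emeasure_lborel_Icc[OF this] True show ?thesis by (simp add: nn_integral_cmult)
    qed simp
    finally show "(\<integral>\<^sup>+y. f x * indicator (cball 0 1) (Complex x y) \<partial>lborel) = \<dots>" .
  qed
  also have "\<dots> = (\<integral>\<^sup>+\<theta>. ?h (- cos \<theta>) * ennreal (sin \<theta>) * indicator {0..pi} \<theta> \<partial>lborel)"
    by (rule nn_integral_substitution_aux)
       (auto intro!: derivative_eq_intros continuous_intros sin_ge_zero)
  also have "\<dots> = (\<integral>\<^sup>+\<theta>. ennreal pi * (f (- cos \<theta>) * (ennreal (2 / pi * (sin \<theta>)\<^sup>2) * indicator {0..pi} \<theta>)) \<partial>lborel)"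
  proof (rule nn_integral_cong)
    fix \<theta> :: real
    show "?h (- cos \<theta>) * ennreal (sin \<theta>) * indicator {0..pi} \<theta>
        = ennreal pi * (f (- cos \<theta>) * (ennreal (2 / pi * (sin \<theta>)\<^sup>2) * indicator {0..pi} \<theta>))"
    proof (cases "\<theta> \<in> {0..pi}")
      case True
      then have s: "sin \<theta> \<ge> 0" by (simp add: sin_ge_zero)
      have "1 - (cos \<theta>)\<^sup>2 = (sin \<theta>)\<^sup>2" by (simp add: sin_squared_eq)
      then have "ennreal (2 * sqrt (1 - (- cos \<theta>)\<^sup>2)) * ennreal (sin \<theta>)
          = ennreal pi * ennreal (2 / pi * (sin \<theta>)\<^sup>2)"
        using s by (simp add: ennreal_mult[symmetric] power2_eq_square)
      then show ?thesis using True by (simp add: mult.assoc) (simp add: ac_simps)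
    qed simp
  qed
  also have "\<dots> = (\<integral>\<^sup>+\<theta>. f (- cos \<theta>) \<partial>zonal_measure) * ennreal pi"
    unfolding zonal_measure_def
    by (simp add: nn_integral_density nn_integral_cmult ac_simps)
  finally show ?thesis by (simp add: mult_divide_eq_ennreal)
qed

lemma sets_sphere3_measure [measurable_cong, simp]: "sets sphere3_measure = sets borel"
  by (simp add: sphere3_measure_def)

lemma space_sphere3_measure [simp]: "space sphere3_measure = UNIV"
  by (simp add: sphere3_measure_def)

lemma prob_space_sphere3_measure: "prob_space sphere3_measure"
  unfolding sphere3_measure_def
  by (intro prob_space.prob_space_distr prob_space_uniform_measure)
     (simp_all add: emeasure_ball unit_ball_vol_4)

text \<open>The matrix of \<open>SU(2)\<close> whose first real coordinate is the inner product with \<open>(p, q)\<close>, so that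
  it carries \<open>(p, q)\<close> to the first axis.\<close>

lemma orthogonal_transformation_SU2:
  fixes p q :: complex
  assumes pq: "(norm p)\<^sup>2 + (norm q)\<^sup>2 = 1"
  shows "orthogonal_transformation (\<lambda>y. (cnj p * fst y + cnj q * snd y, p * snd y - q * fst y))"
  unfolding orthogonal_transformation
proof
  show "linear (\<lambda>y. (cnj p * fst y + cnj q * snd y, p * snd y - q * fst y))"
    by (rule linearI) (auto simp: algebra_simps)
  show "\<forall>y. norm (cnj p * fst y + cnj q * snd y, p * snd y - q * fst y) = norm y"
  proof
    fix y :: "complex \<times> complex"
    obtain a b where y: "y = (a, b)" by (cases y)
    have "(norm (cnj p * a + cnj q * b))\<^sup>2 + (norm (p * b - q * a))\<^sup>2
        = ((norm p)\<^sup>2 + (norm q)\<^sup>2) * ((norm a)\<^sup>2 + (norm b)\<^sup>2)"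
      unfolding cmod_power2 by (simp add: power2_eq_square algebra_simps)
    then show "norm (cnj p * fst y + cnj q * snd y, p * snd y - q * fst y) = norm y"
      by (simp add: y norm_Pair pq)
  qed
qed

text \<open>Rotating the direction of \<open>v\<close> to the first axis replaces
  \<open>v \<bullet> y\<close> by \<open>norm v\<close> times the first real coordinate of
  \<open>y\<close>; the two marginal formulas then apply in turn.\<close>

lemma nn_integral_sphere3_inner:
  assumes [measurable]: "f \<in> borel_measurable borel"
  shows "(\<integral>\<^sup>+y. f (v \<bullet> y) \<partial>sphere3_measure) = (\<integral>\<^sup>+\<theta>. f (- norm v * cos \<theta>) \<partial>zonal_measure)"
proof -
  have "(\<integral>\<^sup>+y. f (v \<bullet> y) \<partial>sphere3_measure) = (\<integral>\<^sup>+y. f (norm v * Re (fst y)) \<partial>sphere3_measure)"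
  \<comment> \<open>For \<open>v = 0\<close> there is no direction to rotate, but both integrands
    are the constant \<open>f 0\<close>.\<close>
  proof (cases "v = 0")
    case False
    obtain p q where v: "v = (p, q)" by (cases v)
    define r where "r = norm v"
    have r: "r > 0" using False by (simp add: r_def)
    have r2: "(norm p)\<^sup>2 + (norm q)\<^sup>2 = r\<^sup>2" by (simp add: r_def v norm_Pair)
    define p' where "p' = p /\<^sub>R r"
    define q' where "q' = q /\<^sub>R r"
    define T where "T = (\<lambda>y::quat. (cnj p' * fst y + cnj q' * snd y, p' * snd y - q' * fst y))"
    have "(norm p')\<^sup>2 + (norm q')\<^sup>2 = ((norm p)\<^sup>2 + (norm q)\<^sup>2) / r\<^sup>2"
      using r by (simp add: p'_def q'_def power_mult_distrib power_inverse field_simps)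
    then have "(norm p')\<^sup>2 + (norm q')\<^sup>2 = 1" using r r2 by simp
    then have T: "orthogonal_transformation T"
      unfolding T_def by (rule orthogonal_transformation_SU2)
    have [measurable]: "T \<in> borel_measurable borel"
      by (intro borel_measurable_continuous_onI linear_continuous_on
            linear_conv_bounded_linear[THEN iffD1] orthogonal_transformation_linear[OF T])
    have eq: "norm v * Re (fst (T y)) = v \<bullet> y" for y
      using r unfolding r_def[symmetric]
      by (simp add: T_def v p'_def q'_def inner_prod_def inner_complex_def field_simps)
    have "(\<integral>\<^sup>+y. f (norm v * Re (fst y)) \<partial>sphere3_measure)
        = (\<integral>\<^sup>+y. f (norm v * Re (fst (T y))) \<partial>sphere3_measure)"
      by (subst distr_sphere3_orthogonal_transformation[OF T, symmetric]) (simp add: nn_integral_distr)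
    then show ?thesis by (simp add: eq)
  qed simp
  also have "\<dots> = (\<integral>\<^sup>+a. f (norm v * Re a) * indicator (cball 0 1) a \<partial>lborel) / ennreal pi"
    by (rule nn_integral_sphere3_fst) simp
  also have "\<dots> = (\<integral>\<^sup>+\<theta>. f (norm v * - cos \<theta>) \<partial>zonal_measure)"
    by (rule nn_integral_disc_Re) simp
  finally show ?thesis by simp
qed

text \<open>As an equality of laws, the formula for nonnegative functions carries over to signed
  ones, including the question of their integrability.\<close>

lemma distr_sphere3_inner:
  "distr sphere3_measure borel ((\<bullet>) v) = distr zonal_measure borel (\<lambda>\<theta>. - norm v * cos \<theta>)"
proof (rule measure_eqI)
  fix A assume "A \<in> sets (distr sphere3_measure borel ((\<bullet>) v))"
  then have [measurable]: "A \<in> sets borel" by simp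
  have "emeasure (distr sphere3_measure borel ((\<bullet>) v)) A = (\<integral>\<^sup>+y. indicator A (v \<bullet> y) \<partial>sphere3_measure)"
    by (simp add: nn_integral_indicator[symmetric] nn_integral_distr del: nn_integral_indicator)
  also have "\<dots> = (\<integral>\<^sup>+\<theta>. indicator A (- norm v * cos \<theta>) \<partial>zonal_measure)"
    by (rule nn_integral_sphere3_inner) simp
  also have "\<dots> = emeasure (distr zonal_measure borel (\<lambda>\<theta>. - norm v * cos \<theta>)) A"
    by (simp add: nn_integral_indicator[symmetric] nn_integral_distr del: nn_integral_indicator)
  finally show "emeasure (distr sphere3_measure borel ((\<bullet>) v)) A
      = emeasure (distr zonal_measure borel (\<lambda>\<theta>. - norm v * cos \<theta>)) A" .
qed simp

lemma
  fixes g :: "real \<Rightarrow> real"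
  assumes [measurable]: "g \<in> borel_measurable borel"
  shows integrable_sphere3_inner: "integrable sphere3_measure (\<lambda>y. g (v \<bullet> y))
      \<longleftrightarrow> integrable zonal_measure (\<lambda>\<theta>. g (- norm v * cos \<theta>))"
    and integral_sphere3_inner: "(\<integral>y. g (v \<bullet> y) \<partial>sphere3_measure)
      = (\<integral>\<theta>. g (- norm v * cos \<theta>) \<partial>zonal_measure)"
proof -
  show "integrable sphere3_measure (\<lambda>y. g (v \<bullet> y)) \<longleftrightarrow> integrable zonal_measure (\<lambda>\<theta>. g (- norm v * cos \<theta>))"
    using integrable_distr_eq[of "(\<bullet>) v" sphere3_measure borel g]
      integrable_distr_eq[of "\<lambda>\<theta>. - norm v * cos \<theta>" zonal_measure borel g]
    by (simp add: distr_sphere3_inner)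
  show "(\<integral>y. g (v \<bullet> y) \<partial>sphere3_measure) = (\<integral>\<theta>. g (- norm v * cos \<theta>) \<partial>zonal_measure)"
    using integral_distr[of "(\<bullet>) v" sphere3_measure borel g]
      integral_distr[of "\<lambda>\<theta>. - norm v * cos \<theta>" zonal_measure borel g]
    by (simp add: distr_sphere3_inner)
qed

text \<open>The total mass is inherited from the sphere: for \<open>v = 0\<close> an image of
  \<open>zonal_measure\<close> equals an image of \<open>sphere3_measure\<close>, and images
  preserve mass.\<close>

lemma prob_space_zonal_measure: "prob_space zonal_measure"
proof -
  have "prob_space (distr sphere3_measure borel ((\<bullet>) 0))"
    by (intro prob_space.prob_space_distr prob_space_sphere3_measure) simp
  then show ?thesis
    by (subst (asm) distr_sphere3_inner) (rule prob_space_distrD, simp_all)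
qed

section \<open>The logarithmic integrals\<close>

text \<open>The Weierstrass test gives uniform convergence, which permits integration term by term.
  Both logarithmic series below are integrated this way, with majorant
  \<open>\<rho> ^ n\<close>.\<close>

lemma
  fixes g :: "nat \<Rightarrow> real \<Rightarrow> real"
  assumes g: "\<And>n. (g n has_integral I n) {a..b}" "\<And>n. continuous_on {a..b} (g n)"
    and M: "\<And>n x. x \<in> {a..b} \<Longrightarrow> norm (g n x) \<le> M n" "summable M"
    and G: "\<And>x. x \<in> {a..b} \<Longrightarrow> (\<lambda>n. g n x) sums G x"
  shows summable_integral_uniform: "summable I"
    and has_integral_suminf_uniform: "(G has_integral suminf I) {a..b}"
proof -
  have "uniform_limit {a..b} (\<lambda>n x. \<Sum>i<n. g i x) (\<lambda>x. suminf (\<lambda>i. g i x)) sequentially"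
    using M by (rule Weierstrass_m_test)
  moreover have "continuous_on {a..b} (\<lambda>x. \<Sum>i<n. g i x)" for n
    by (intro continuous_intros g)
  ultimately obtain I' J where I': "\<And>n. ((\<lambda>x. \<Sum>i<n. g i x) has_integral I' n) {a..b}"
      and J: "((\<lambda>x. suminf (\<lambda>i. g i x)) has_integral J) {a..b}" "I' \<longlonglongrightarrow> J"
    by (rule uniform_limit_integral) auto
  have "((\<lambda>x. \<Sum>i<n. g i x) has_integral (\<Sum>i<n. I i)) {a..b}" for n
    by (intro has_integral_sum g) auto
  with I' have "I' = (\<lambda>n. \<Sum>i<n. I i)" by (metis has_integral_unique ext)
  with J have s: "I sums J" by (simp add: sums_def)
  then show "summable I" by (rule sums_summable)
  have "(G has_integral J) {a..b}"
    using J(1) by (rule has_integral_eq[rotated]) (use G in \<open>auto intro: sums_unique[symmetric]\<close>)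
  then show "(G has_integral suminf I) {a..b}" by (simp add: sums_unique[OF s, symmetric])
qed

lemma divide_of_nat_le:
  fixes x :: real
  assumes "0 \<le> x"
  shows "x / real n \<le> x"
proof (cases "n = 0")
  case False
  then have "x * 1 \<le> x * real n" using assms by (intro mult_left_mono) auto
  then show ?thesis using False by (simp add: divide_le_eq)
qed (use assms in simp)

lemma one_minus_2_cos_pos:
  fixes \<rho> \<theta> :: real
  assumes "\<bar>\<rho>\<bar> \<noteq> 1"
  shows "0 < 1 - 2 * \<rho> * cos \<theta> + \<rho>\<^sup>2"
proof -
  have "\<bar>\<rho> * cos \<theta>\<bar> \<le> \<bar>\<rho>\<bar> * 1"
    unfolding abs_mult by (intro mult_left_mono) auto
  then have "\<rho> * cos \<theta> \<le> \<bar>\<rho>\<bar> * 1" by linarith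
  moreover have "(1 - \<bar>\<rho>\<bar>)\<^sup>2 > 0" using assms by simp
  ultimately show ?thesis by (simp add: power2_diff)
qed

text \<open>This is the real part of the power series of \<open>ln (1 - w)\<close> at
  \<open>w = rcis \<rho> \<theta>\<close>. The term \<open>n = 0\<close> is 0 because division by
  zero yields 0.\<close>

lemma cos_series_ln:
  fixes \<rho> \<theta> :: real
  assumes "0 \<le> \<rho>" "\<rho> < 1"
  shows "(\<lambda>n. - (\<rho> ^ n * cos (n * \<theta>) / n)) sums (ln (1 - 2 * \<rho> * cos \<theta> + \<rho>\<^sup>2) / 2)"
proof -
  define w where "w = rcis \<rho> \<theta>"
  have nw: "norm w < 1" using assms by (simp add: w_def)
  have sum: "(\<lambda>n. Re (- (w ^ n / of_nat n))) sums Re (ln (1 - w))"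
    using sums_Re[OF Ln_series'[of "- w"]] nw by simp
  have re: "Re (w ^ n / of_nat n) = \<rho> ^ n * cos (n * \<theta>) / n" for n
    by (simp add: w_def DeMoivre2 Re_divide_of_nat)
  have "1 - w \<noteq> 0" using nw by auto
  then have l1: "Re (ln (1 - w)) = ln (norm (1 - w))" by simp
  have l2: "norm (1 - w) = sqrt (1 - 2 * \<rho> * cos \<theta> + \<rho>\<^sup>2)"
  proof -
    have "(1 - \<rho> * cos \<theta>)\<^sup>2 + (\<rho> * sin \<theta>)\<^sup>2 = 1 - 2 * \<rho> * cos \<theta> + \<rho>\<^sup>2"
      by (simp add: power_mult_distrib power2_diff sin_squared_eq algebra_simps)
    then show ?thesis by (simp add: cmod_def w_def)
  qed
  have l3: "ln (sqrt (1 - 2 * \<rho> * cos \<theta> + \<rho>\<^sup>2)) = ln (1 - 2 * \<rho> * cos \<theta> + \<rho>\<^sup>2) / 2"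
    using one_minus_2_cos_pos[of \<rho> \<theta>] assms by (subst ln_sqrt) auto
  from sum show ?thesis by (simp only: uminus_complex.sel re l1 l2 l3)
qed

text \<open>The weight \<open>(sin \<theta>)\<^sup>2\<close> is
  \<open>(1 - cos (2 * \<theta>)) / 2\<close>, hence orthogonal to every cosine of positive
  frequency other than 2. At frequency 2 the product leaves the constant
  \<open>- 1 / 4\<close>.\<close>

lemma has_integral_cos_sin_sq:
  fixes n :: nat
  assumes "n \<noteq> 0"
  shows "((\<lambda>\<theta>. cos (n * \<theta>) * (sin \<theta>)\<^sup>2) has_integral (if n = 2 then - pi / 4 else 0)) {0..pi}"
proof (cases "n = 2")
  case True
  have *: "cos (2 * \<theta>) * (sin \<theta>)\<^sup>2 = cos (2 * \<theta>) / 2 - cos (4 * \<theta>) / 4 - 1 / 4" for \<theta> :: real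
  proof -
    have "cos (4 * \<theta>) = 2 * (cos (2 * \<theta>))\<^sup>2 - 1" using cos_double_cos[of "2 * \<theta>"] by simp
    moreover have "(sin \<theta>)\<^sup>2 = (1 - cos (2 * \<theta>)) / 2" by (simp add: cos_double_sin)
    ultimately show ?thesis by (simp only:) (simp add: power2_eq_square field_simps)
  qed
  let ?A = "\<lambda>\<theta>::real. sin (2 * \<theta>) / 4 - sin (4 * \<theta>) / 16 - \<theta> / 4"
  have "((\<lambda>\<theta>. cos (2 * \<theta>) / 2 - cos (4 * \<theta>) / 4 - 1 / 4) has_integral (?A pi - ?A 0)) {0..pi}"
    by (rule fundamental_theorem_of_calculus)
       (auto intro!: derivative_eq_intros simp flip: has_real_derivative_iff_has_vector_derivative)
  moreover have "sin (4 * pi) = 0" using sin_npi[of 4] by simp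
  ultimately show ?thesis using True by (simp add: *)
next
  case False
  \<comment> \<open>With a real \<open>m\<close> the frequency \<open>m - 2\<close> is -1 when
    \<open>n = 1\<close>, where subtraction in \<open>nat\<close> would truncate.\<close>
  define m where "m = real n"
  have m: "m \<noteq> 0" "m \<noteq> 2" "m + 2 \<noteq> 0" "m - 2 \<noteq> 0" using False assms by (auto simp: m_def)
  have *: "cos (m * \<theta>) * (sin \<theta>)\<^sup>2 = cos (m * \<theta>) / 2 - cos ((m + 2) * \<theta>) / 4 - cos ((m - 2) * \<theta>) / 4" for \<theta> :: real
  proof -
    have p: "cos ((m + 2) * \<theta>) + cos ((m - 2) * \<theta>) = 2 * cos (m * \<theta>) * cos (2 * \<theta>)"
      by (simp add: ring_distribs cos_add cos_diff)
    have s: "(sin \<theta>)\<^sup>2 = (1 - cos (2 * \<theta>)) / 2" by (simp add: cos_double_sin)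
    have "cos (m * \<theta>) * (sin \<theta>)\<^sup>2 = cos (m * \<theta>) / 2 - 2 * cos (m * \<theta>) * cos (2 * \<theta>) / 4"
      unfolding s by (simp add: right_diff_distrib)
    then show ?thesis unfolding p[symmetric] by (simp only: add_divide_distrib diff_diff_eq)
  qed
  have h: "((\<lambda>\<theta>. cos (k * \<theta>)) has_integral 0) {0..pi}" if "k \<noteq> 0" "sin (k * pi) = 0" for k :: real
  proof -
    have "((\<lambda>\<theta>. cos (k * \<theta>)) has_integral (sin (k * pi) / k - sin (k * 0) / k)) {0..pi}"
      using that by (intro fundamental_theorem_of_calculus)
        (auto intro!: derivative_eq_intros simp flip: has_real_derivative_iff_has_vector_derivative)
    then show ?thesis using that by simp
  qed
  have "sin (m * pi) = 0" "sin ((m + 2) * pi) = 0" "sin ((m - 2) * pi) = 0"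
    by (simp_all add: m_def ring_distribs sin_add sin_diff)
  then have "((\<lambda>\<theta>. cos (m * \<theta>) / 2 - cos ((m + 2) * \<theta>) / 4 - cos ((m - 2) * \<theta>) / 4) has_integral (0 / 2 - 0 / 4 - 0 / 4)) {0..pi}"
    using m by (intro has_integral_diff has_integral_divide h)
  then show ?thesis using False by (simp add: * flip: m_def)
qed

lemma has_integral_ln_sin_sq:
  fixes \<rho> :: real
  assumes "0 \<le> \<rho>" "\<rho> < 1"
  shows "((\<lambda>\<theta>. ln (1 - 2 * \<rho> * cos \<theta> + \<rho>\<^sup>2) / 2 * (sin \<theta>)\<^sup>2) has_integral (pi * \<rho>\<^sup>2 / 8)) {0..pi}"
proof -
  \<comment> \<open>The value at 2 is \<open>- (\<rho>\<^sup>2 / 2)\<close> from the series times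
    \<open>- pi / 4\<close> from the previous lemma.\<close>
  define I where "I = (\<lambda>n. if n = (2::nat) then pi * \<rho>\<^sup>2 / 8 else 0)"
  let ?g = "\<lambda>(n::nat) (\<theta>::real). - (\<rho> ^ n * cos (n * \<theta>) / n) * (sin \<theta>)\<^sup>2"
  have "((\<lambda>\<theta>. ln (1 - 2 * \<rho> * cos \<theta> + \<rho>\<^sup>2) / 2 * (sin \<theta>)\<^sup>2) has_integral suminf I) {0..pi}"
  proof (rule has_integral_suminf_uniform)
    fix n :: nat
    show "(?g n has_integral I n) {0..pi}"
    proof (cases "n = 0")
      case False
      from has_integral_mult_right[OF has_integral_cos_sin_sq[OF this], of "- (\<rho> ^ n / n)"]
      show ?thesis by (simp add: I_def ac_simps split: if_splits)
    qed (simp add: I_def)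
    show "continuous_on {0..pi} (?g n)" by (cases "n = 0") (auto intro!: continuous_intros)
    fix \<theta> :: real
    have "\<bar>cos (n * \<theta>)\<bar> * (sin \<theta>)\<^sup>2 \<le> 1 * 1"
      by (intro mult_mono) (auto simp: abs_square_le_1)
    then have "\<rho> ^ n * (\<bar>cos (n * \<theta>)\<bar> * (sin \<theta>)\<^sup>2) \<le> \<rho> ^ n"
      using assms mult_left_mono[of _ 1 "\<rho> ^ n"] by simp
    moreover have "\<rho> ^ n * (\<bar>cos (n * \<theta>)\<bar> * (sin \<theta>)\<^sup>2) / n \<le> \<rho> ^ n * (\<bar>cos (n * \<theta>)\<bar> * (sin \<theta>)\<^sup>2)"
      using assms by (intro divide_of_nat_le) simp
    ultimately show "norm (?g n \<theta>) \<le> \<rho> ^ n"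
      using assms by (simp add: abs_mult)
  next
    show "summable (\<lambda>n. \<rho> ^ n)" using assms by simp
    show "(\<lambda>n. ?g n \<theta>) sums (ln (1 - 2 * \<rho> * cos \<theta> + \<rho>\<^sup>2) / 2 * (sin \<theta>)\<^sup>2)" for \<theta>
      using assms by (intro sums_mult2 cos_series_ln)
  qed
  moreover have "suminf I = pi * \<rho>\<^sup>2 / 8"
    unfolding I_def by (rule sums_unique[symmetric]) (rule sums_single)
  ultimately show ?thesis by simp
qed

section \<open>The boundary value of the logarithmic integral and the L-value\<close>

lemma cos_le_half:
  assumes "\<theta> \<in> {pi/3..pi}"
  shows "cos \<theta> \<le> 1/2"
  using cos_monotone_0_pi_le[of "pi/3" \<theta>] assms by (simp add: cos_60)

lemma half_le_cos:
  assumes "\<theta> \<in> {0..pi/3}"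
  shows "1/2 \<le> cos \<theta>"
  using cos_monotone_0_pi_le[of \<theta> "pi/3"] assms by (simp add: cos_60)

text \<open>Away from \<open>\<theta> = 0\<close> the expression is at least
  \<open>1 - \<rho> + \<rho>\<^sup>2\<close>, so it stays positive even at
  \<open>\<rho> = 1\<close>. This gives the continuity needed for the passage to the
  boundary.\<close>

lemma one_minus_2_cos_pos':
  fixes \<rho> \<theta> :: real
  assumes "\<theta> \<in> {pi/3..pi}" "0 \<le> \<rho>"
  shows "0 < 1 - 2 * \<rho> * cos \<theta> + \<rho>\<^sup>2"
proof -
  have "\<rho> * cos \<theta> \<le> \<rho> * (1/2)" using assms cos_le_half by (intro mult_left_mono) auto
  moreover have "0 < (\<rho> - 1/2)\<^sup>2 + 3/4" by (simp add: add_nonneg_pos)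
  then have "0 < 1 - \<rho> + \<rho>\<^sup>2" by (simp add: power2_eq_square algebra_simps)
  ultimately show ?thesis by simp
qed

lemma has_integral_ln_Abel:
  fixes \<rho> :: real
  assumes \<rho>: "0 \<le> \<rho>" "\<rho> < 1"
  shows "((\<lambda>\<theta>. ln (1 - 2 * \<rho> * cos \<theta> + \<rho>\<^sup>2) / 2) has_integral (\<Sum>n. \<rho> ^ n * sin (n * (pi/3)) / (real n)\<^sup>2)) {pi/3..pi}"
proof (rule has_integral_suminf_uniform)
  let ?g = "\<lambda>(n::nat) (\<theta>::real). - (\<rho> ^ n * cos (n * \<theta>) / n)"
  fix n :: nat
  show "(?g n has_integral \<rho> ^ n * sin (n * (pi/3)) / (real n)\<^sup>2) {pi/3..pi}"
  proof (cases "n = 0")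
    case False
    \<comment> \<open>Only the lower endpoint contributes, since
      \<open>sin (n * pi) = 0\<close>.\<close>
    let ?A = "\<lambda>\<theta>::real. - (\<rho> ^ n * sin (n * \<theta>) / (real n)\<^sup>2)"
    have "(?g n has_integral (?A pi - ?A (pi/3))) {pi/3..pi}"
      using False by (intro fundamental_theorem_of_calculus)
       (auto intro!: derivative_eq_intros simp: field_simps power2_eq_square simp flip: has_real_derivative_iff_has_vector_derivative)
    then show ?thesis by simp
  qed simp
  show "continuous_on {pi/3..pi} (?g n)" by (cases "n = 0") (auto intro!: continuous_intros)
  fix \<theta> :: real
  have "\<rho> ^ n * \<bar>cos (n * \<theta>)\<bar> \<le> \<rho> ^ n"
    using \<rho> mult_left_mono[of _ 1 "\<rho> ^ n"] by simp
  moreover have "\<rho> ^ n * \<bar>cos (n * \<theta>)\<bar> / n \<le> \<rho> ^ n * \<bar>cos (n * \<theta>)\<bar>"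
    using \<rho> by (intro divide_of_nat_le) simp
  ultimately show "norm (?g n \<theta>) \<le> \<rho> ^ n"
    using \<rho> by (simp add: abs_mult)
next
  show "summable (\<lambda>n. \<rho> ^ n)" using \<rho> by simp
  show "(\<lambda>n. - (\<rho> ^ n * cos (n * \<theta>) / n)) sums (ln (1 - 2 * \<rho> * cos \<theta> + \<rho>\<^sup>2) / 2)" for \<theta> :: real
    using \<rho> by (rule cos_series_ln)
qed

text \<open>Abel's argument: integral and series are both continuous in \<open>\<rho>\<close> on
  \<open>{0..1}\<close>, the series by the majorant \<open>1 / (real n)\<^sup>2\<close>. They agree
  for \<open>\<rho> < 1\<close>, so their difference \<open>?D\<close> also vanishes at 1.\<close>

lemma has_integral_ln_two_minus_two_cos:
  "((\<lambda>\<theta>. ln (2 - 2 * cos \<theta>) / 2) has_integral (\<Sum>n. sin (n * (pi/3)) / (real n)\<^sup>2)) {pi/3..pi}"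
proof -
  let ?f = "\<lambda>\<rho> \<theta>::real. ln (1 - 2 * \<rho> * cos \<theta> + \<rho>\<^sup>2) / 2"
  let ?t = "\<lambda>(n::nat) \<rho>::real. \<rho> ^ n * sin (n * (pi/3)) / (real n)\<^sup>2"
  let ?D = "\<lambda>\<rho>. integral {pi/3..pi} (?f \<rho>) - (\<Sum>n. ?t n \<rho>)"
  have cont: "continuous_on ({0..1} \<times> {pi/3..pi}) (\<lambda>(\<rho>, \<theta>). ?f \<rho> \<theta>)"
    unfolding case_prod_beta
    by (intro continuous_intros) (use one_minus_2_cos_pos' in force, simp)
  have "continuous_on {0..1} (\<lambda>\<rho>. integral (cbox (pi/3) pi) (?f \<rho>))"
    using cont by (intro integral_continuous_on_param) simp
  moreover have "continuous_on {0..1} (\<lambda>\<rho>. \<Sum>n. ?t n \<rho>)"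
  proof (rule uniform_limit_theorem)
    show "uniform_limit {0..1} (\<lambda>n \<rho>. \<Sum>i<n. ?t i \<rho>) (\<lambda>\<rho>. \<Sum>n. ?t n \<rho>) sequentially"
    proof (rule Weierstrass_m_test)
      show "norm (?t n \<rho>) \<le> 1 / (real n)\<^sup>2" if "\<rho> \<in> {0..1}" for n \<rho>
      proof -
        have "\<bar>\<rho> ^ n\<bar> * \<bar>sin (n * (pi/3))\<bar> \<le> 1 * 1"
          using that by (intro mult_mono) (auto simp: power_le_one)
        then show ?thesis by (simp add: abs_mult divide_right_mono)
      qed
      show "summable (\<lambda>n. 1 / (real n)\<^sup>2)"
        using inverse_power_summable[of 2, where 'a = real] by (simp add: inverse_eq_divide)
    qed
    show "\<forall>\<^sub>F n in sequentially. continuous_on {0..1} (\<lambda>\<rho>. \<Sum>i<n. ?t i \<rho>)"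
    proof (intro always_eventually allI continuous_on_sum)
      show "continuous_on {0..1} (?t i)" for i by (cases "i = 0") (auto intro!: continuous_intros)
    qed
  qed simp
  ultimately have "continuous_on {0..1} ?D"
    by (intro continuous_intros) simp_all
  moreover have "?D \<rho> = 0" if "\<rho> \<in> {0..<1}" for \<rho>
  proof -
    have "integral {pi/3..pi} (?f \<rho>) = (\<Sum>n. ?t n \<rho>)"
      using that by (intro integral_unique has_integral_ln_Abel) auto
    then show ?thesis by (simp only: diff_self)
  qed
  moreover have "closure {0..<1::real} = {0..1}" by simp
  ultimately have "?D 1 = 0"
    using continuous_constant_on_closure[of "{0..<1}" ?D 0 1] by simp
  moreover have "?f 1 integrable_on {pi/3..pi}"
    by (intro integrable_continuous_interval continuous_intros)
       (use one_minus_2_cos_pos'[of _ 1] in force, simp)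
  ultimately show ?thesis by (simp add: has_integral_iff)
qed

text \<open>Both sides change sign under \<open>n \<mapsto> n + 3\<close>: the sine is shifted by
  \<open>pi\<close>, while the character has period 3 and the power of -1 flips. Only
  \<open>n < 3\<close> remains.\<close>

lemma sin_third_chi: "sin (n * (pi/3)) = sqrt 3 / 2 * ((-1) ^ Suc n * chi_m3 n)"
proof (induction n rule: less_induct)
  case (less n)
  show ?case
  proof (cases "n < 3")
    case True
    then consider "n = 0" | "n = 1" | "n = 2" by linarith
    then show ?thesis
      using sin_double[of "pi/3"] by cases (simp_all add: chi_m3_def sin_60 cos_60)
  next
    case False
    then obtain k where k: "n = k + 3" by (metis add.commute le_Suc_ex not_less)
    have "real n * (pi/3) = real k * (pi/3) + pi" by (simp add: k field_simps)
    then have "sin (n * (pi/3)) = - sin (k * (pi/3))" by (simp only: sin_periodic_pi)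
    moreover have "chi_m3 n = chi_m3 k" by (simp add: k chi_m3_def)
    ultimately show ?thesis using less[of k] by (simp add: k power_add)
  qed
qed

text \<open>The alternating sign is removed by subtracting the even terms twice. As the character is
  -1 at 2, the even terms sum to \<open>- 1/4 * L_chi_m3_2\<close>, so the alternating series is 3/2
  times \<open>L_chi_m3_2\<close>.\<close>

lemma suminf_sin_third: "(\<Sum>n. sin (n * (pi/3)) / (real n)\<^sup>2) = 3 * sqrt 3 / 4 * L_chi_m3_2"
proof -
  define a where "a = (\<lambda>n. chi_m3 n / (real n)\<^sup>2)"
  have "summable a"
  proof (rule summable_comparison_test')
    show "summable (\<lambda>n. 1 / (real n)\<^sup>2)"
      using inverse_power_summable[of 2, where 'a = real] by (simp add: inverse_eq_divide)
    show "norm (a n) \<le> 1 / (real n)\<^sup>2" for n by (simp add: a_def chi_m3_def)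
  qed
  then have "summable (\<lambda>n. a (Suc n))" by (simp add: summable_Suc_iff)
  then have "(\<lambda>n. a (Suc n)) sums L_chi_m3_2"
    unfolding L_chi_m3_2_def a_def by (rule summable_sums)
  \<comment> \<open>The index may start at 0 because \<open>a 0 = 0\<close>.\<close>
  then have a: "a sums L_chi_m3_2"
    by (subst (asm) sums_Suc_iff) (simp add: a_def)
  define e where "e = (\<lambda>n. if even n then a n else 0)"
  have "a (2 * k) = - 1/4 * a k" for k
  proof -
    have "k mod 3 = 0 \<or> k mod 3 = 1 \<or> k mod 3 = 2" by linarith
    then have "chi_m3 (2 * k) = - chi_m3 k"
      by (auto simp: chi_m3_def mod_mult_right_eq[of 2 k 3, symmetric])
    then show ?thesis by (simp add: a_def power_mult_distrib)
  qed
  then have "(\<lambda>k. e (2 * k)) sums (- 1/4 * L_chi_m3_2)"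
    using sums_mult[OF a, of "- 1/4"] by (simp add: e_def)
  then have "e sums (- 1/4 * L_chi_m3_2)"
    by (subst (asm) sums_mono_reindex) (auto simp: strict_mono_def e_def elim!: evenE)
  then have "(\<lambda>n. sqrt 3 / 2 * (a n - 2 * e n)) sums (sqrt 3 / 2 * (L_chi_m3_2 - 2 * (- 1/4 * L_chi_m3_2)))"
    by (intro sums_mult sums_diff a)
  moreover have "sqrt 3 / 2 * (a n - 2 * e n) = sin (n * (pi/3)) / (real n)\<^sup>2" for n
    unfolding sin_third_chi a_def e_def by simp
  ultimately show ?thesis by (simp add: sums_iff)
qed

section \<open>The average of the logarithm over the 3-sphere\<close>

lemma AE_zonal_measure: "AE \<theta> in zonal_measure. \<theta> \<in> {0..pi}"
  unfolding zonal_measure_def by (subst AE_density) (auto simp: indicator_def)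

lemma AE_zonal_measure_neq: "AE \<theta> in zonal_measure. \<theta> \<noteq> c"
  unfolding zonal_measure_def
  by (subst AE_density) (auto intro: AE_mp[OF AE_lborel_singleton[of c]])

lemma integrable_zonal_measure_bounded:
  fixes g :: "real \<Rightarrow> real"
  assumes "g \<in> borel_measurable borel" "\<And>\<theta>. \<theta> \<in> {0..pi} \<Longrightarrow> \<bar>g \<theta>\<bar> \<le> B"
  shows "integrable zonal_measure g"
proof -
  interpret prob_space zonal_measure by (rule prob_space_zonal_measure)
  show ?thesis
  proof (rule integrable_const_bound)
    show "AE \<theta> in zonal_measure. norm (g \<theta>) \<le> B"
      using AE_zonal_measure by eventually_elim (use assms(2) in simp)
  qed (use assms(1) in simp)
qed

text \<open>Links the Bochner integral to the gauge integral, where antiderivatives are at hand; the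
  values agree by uniqueness of the latter.\<close>

lemma integral_zonal_measure:
  fixes g :: "real \<Rightarrow> real"
  assumes [measurable]: "g \<in> borel_measurable borel" and int: "integrable zonal_measure g"
    and I: "((\<lambda>\<theta>. g \<theta> * (sin \<theta>)\<^sup>2) has_integral I) {0..pi}"
  shows "(\<integral>\<theta>. g \<theta> \<partial>zonal_measure) = 2 / pi * I"
proof -
  let ?d = "\<lambda>\<theta>. 2 / pi * (sin \<theta>)\<^sup>2 * indicator {0..pi} \<theta>"
  have W: "zonal_measure = density lborel (\<lambda>\<theta>. ennreal (?d \<theta>))"
    unfolding zonal_measure_def by (intro density_cong) (auto simp: indicator_def)
  have "integrable lborel (\<lambda>\<theta>. ?d \<theta> * g \<theta>)"
    using int unfolding W by (subst (asm) integrable_real_density) auto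
  then have "((\<lambda>\<theta>. ?d \<theta> * g \<theta>) has_integral (\<integral>\<theta>. ?d \<theta> * g \<theta> \<partial>lborel)) UNIV"
    by (rule has_integral_integral_lborel)
  moreover have "(\<integral>\<theta>. ?d \<theta> * g \<theta> \<partial>lborel) = (\<integral>\<theta>. g \<theta> \<partial>zonal_measure)"
    unfolding W by (subst integral_real_density) auto
  moreover have "((\<lambda>\<theta>. ?d \<theta> * g \<theta>) has_integral (2 / pi * I)) UNIV"
  proof -
    have "((\<lambda>\<theta>. if \<theta> \<in> {0..pi} then 2 / pi * (g \<theta> * (sin \<theta>)\<^sup>2) else 0) has_integral (2 / pi * I)) UNIV"
      by (subst has_integral_restrict_UNIV) (intro has_integral_mult_right I)
    then show ?thesis
      by (rule has_integral_eq[rotated]) (auto simp: indicator_def)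
  qed
  ultimately show ?thesis by (metis has_integral_unique)
qed

text \<open>The average of \<open>ln |v + y|\<close> over \<open>y \<in> S\<^sup>3\<close>, as a function of \<open>r = |v|\<close>.\<close>

definition log_potential :: "real \<Rightarrow> real" where
  "log_potential r = (if r \<le> 1 then r\<^sup>2 / 4 else ln r + 1 / (4 * r\<^sup>2))"

lemma log_potential_nonneg: "0 \<le> r \<Longrightarrow> 0 \<le> log_potential r"
  by (simp add: log_potential_def add_nonneg_nonneg)

lemma borel_measurable_log_potential [measurable]: "log_potential \<in> borel_measurable borel"
  unfolding log_potential_def[abs_def] by measurable

text \<open>The argument of the logarithm lies between \<open>(1 - r)\<^sup>2\<close> and
  \<open>(1 + r)\<^sup>2\<close>, so for \<open>r \<noteq> 1\<close> the integrand is
  bounded.\<close>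

lemma integrable_zonal_ln:
  assumes "0 \<le> r" "r \<noteq> 1"
  shows "integrable zonal_measure (\<lambda>\<theta>. ln (1 - 2 * r * cos \<theta> + r\<^sup>2) / 2)"
proof (rule integrable_zonal_measure_bounded)
  fix \<theta> :: real
  let ?u = "1 - 2 * r * cos \<theta> + r\<^sup>2"
  have "r * cos \<theta> \<le> r * 1" "r * (-1) \<le> r * cos \<theta>"
    using assms by (intro mult_left_mono; simp)+
  then have u: "(1 - r)\<^sup>2 \<le> ?u" "?u \<le> (1 + r)\<^sup>2"
    by (simp_all add: power2_eq_square algebra_simps)
  have p: "0 < (1 - r)\<^sup>2" using assms by simp
  then have "0 < ?u" using u by linarith
  then have "ln ((1 - r)\<^sup>2) \<le> ln ?u" "ln ?u \<le> ln ((1 + r)\<^sup>2)"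
    using u p by (subst ln_le_cancel_iff; linarith)+
  then show "\<bar>ln ?u / 2\<bar> \<le> \<bar>ln ((1 - r)\<^sup>2)\<bar> + \<bar>ln ((1 + r)\<^sup>2)\<bar>" by linarith
qed measurable

lemma integral_zonal_ln:
  assumes "0 \<le> r" "r \<noteq> 1"
  shows "(\<integral>\<theta>. ln (1 - 2 * r * cos \<theta> + r\<^sup>2) / 2 \<partial>zonal_measure) = log_potential r"
proof -
  have less: "(\<integral>\<theta>. ln (1 - 2 * r * cos \<theta> + r\<^sup>2) / 2 \<partial>zonal_measure) = r\<^sup>2 / 4"
    if "0 \<le> r" "r < 1" for r
    using that
    by (subst integral_zonal_measure[OF _ integrable_zonal_ln has_integral_ln_sin_sq]) auto
  show ?thesis
  proof (cases "r < 1")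
    case True
    then show ?thesis using less[of r] assms by (simp add: log_potential_def)
  next
    case False
    interpret prob_space zonal_measure by (rule prob_space_zonal_measure)
    \<comment> \<open>Factoring \<open>r\<^sup>2\<close> out of the argument yields the same
      expression at \<open>s < 1\<close> and splits off \<open>ln r\<close>.\<close>
    define s where "s = 1 / r"
    have s: "0 \<le> s" "s < 1" "r = 1 / s" "r > 1" using False assms by (auto simp: s_def)
    have "ln (1 - 2 * r * cos \<theta> + r\<^sup>2) / 2 = ln r + ln (1 - 2 * s * cos \<theta> + s\<^sup>2) / 2" for \<theta>
    proof -
      have e: "1 - 2 * r * cos \<theta> + r\<^sup>2 = r\<^sup>2 * (1 - 2 * s * cos \<theta> + s\<^sup>2)"
        using s(4) by (simp add: s_def power2_eq_square field_simps)
      have "ln (1 - 2 * r * cos \<theta> + r\<^sup>2) = ln (r\<^sup>2) + ln (1 - 2 * s * cos \<theta> + s\<^sup>2)"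
        unfolding e by (rule ln_mult_pos) (use one_minus_2_cos_pos[of s \<theta>] s(1,2,4) in auto)
      then show ?thesis using s(4) by (simp add: ln_realpow)
    qed
    then have "(\<integral>\<theta>. ln (1 - 2 * r * cos \<theta> + r\<^sup>2) / 2 \<partial>zonal_measure)
        = (\<integral>\<theta>. ln r + ln (1 - 2 * s * cos \<theta> + s\<^sup>2) / 2 \<partial>zonal_measure)" by (simp only:)
    also have "\<dots> = ln r + s\<^sup>2 / 4"
      using s integrable_zonal_ln[of s] less[of s] prob_space
      by (subst Bochner_Integration.integral_add) simp_all
    finally show ?thesis using s(4) by (simp add: log_potential_def s_def power_divide)
  qed
qed

text \<open>The radial projection sends the origin to 0 by the convention
  \<open>inverse 0 = 0\<close>, but the origin is a null set.\<close>

lemma AE_sphere3_norm: "AE y in sphere3_measure. norm y = 1"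
proof -
  have "AE x in uniform_measure lborel (ball 0 1 :: quat set). x \<noteq> 0"
    using AE_lborel_singleton[of "0::quat"]
    by (intro AE_uniform_measureI) (auto elim!: eventually_mono)
  then show ?thesis
    unfolding sphere3_measure_def
    by (subst AE_distr_iff) (auto elim!: eventually_mono)
qed

lemma norm_add_sphere3:
  fixes v y :: "'a::real_inner"
  assumes "norm y = 1"
  shows "norm (v + y) = sqrt (1 + 2 * (v \<bullet> y) + (norm v)\<^sup>2)"
  using assms by (simp add: norm_eq_sqrt_inner inner_add inner_commute algebra_simps)

text \<open>For \<open>norm y = 1\<close> the integrand depends on \<open>v \<bullet> y\<close>
  alone, so its average is a zonal integral. The assumption on \<open>norm v\<close> keeps
  \<open>v + y\<close> away from 0.\<close>

lemma
  assumes "norm v \<noteq> 1"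
  shows integrable_sphere3_ln: "integrable sphere3_measure (\<lambda>y. ln (norm (v + y)))"
    and integral_sphere3_ln: "(\<integral>y. ln (norm (v + y)) \<partial>sphere3_measure) = log_potential (norm v)"
proof -
  let ?g = "\<lambda>s. ln (1 + 2 * s + (norm v)\<^sup>2) / 2"
  have AE: "AE y in sphere3_measure. ln (norm (v + y)) = ?g (v \<bullet> y)"
    using AE_sphere3_norm
  proof eventually_elim
    case (elim y)
    have "v + y \<noteq> 0" using elim assms by (metis add_eq_0_iff norm_minus_cancel)
    then have "0 < 1 + 2 * (v \<bullet> y) + (norm v)\<^sup>2"
      using norm_add_sphere3[OF elim, of v] by (metis real_sqrt_gt_0_iff zero_less_norm_iff)
    then show ?case by (simp add: norm_add_sphere3[OF elim] ln_sqrt)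
  qed
  have "integrable sphere3_measure (\<lambda>y. ?g (v \<bullet> y))"
    using assms integrable_zonal_ln[of "norm v"]
    by (subst integrable_sphere3_inner) (simp_all add: ac_simps)
  with AE show "integrable sphere3_measure (\<lambda>y. ln (norm (v + y)))"
    by (subst integrable_cong_AE) auto
  have "(\<integral>y. ln (norm (v + y)) \<partial>sphere3_measure) = (\<integral>y. ?g (v \<bullet> y) \<partial>sphere3_measure)"
    using AE by (intro integral_cong_AE) auto
  also have "\<dots> = (\<integral>\<theta>. ?g (- norm v * cos \<theta>) \<partial>zonal_measure)"
    by (rule integral_sphere3_inner) simp
  also have "\<dots> = log_potential (norm v)"
    using assms integral_zonal_ln[of "norm v"] by (simp add: ac_simps)
  finally show "(\<integral>y. ln (norm (v + y)) \<partial>sphere3_measure) = log_potential (norm v)" .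
qed

text \<open>Only the lower tail of the logarithm is unbounded, so \<open>|ln|\<close> is controlled by \<open>- ln\<close>,
  whose average is known.\<close>

lemma abs_ln_le:
  fixes s :: real
  assumes "0 \<le> s" "s \<le> 3"
  shows "\<bar>ln s\<bar> \<le> 2 * ln 3 - ln s"
proof (cases "s = 0")
  case False
  then have "ln s \<le> ln 3" using assms by simp
  moreover have "0 \<le> ln (3::real)" by simp
  ultimately show ?thesis by linarith
qed simp

text \<open>The bound is uniform in \<open>v\<close>, as the Fubini argument on the product
  requires. Here 3 bounds \<open>norm (v + y)\<close>, and the subtracted average
  \<open>log_potential (norm v)\<close> is nonnegative.\<close>

lemma integral_sphere3_abs_ln_le:
  assumes "norm v \<noteq> 1" "norm v \<le> 2"
  shows "(\<integral>y. \<bar>ln (norm (v + y))\<bar> \<partial>sphere3_measure) \<le> 2 * ln 3"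
proof -
  interpret prob_space sphere3_measure by (rule prob_space_sphere3_measure)
  have "(\<integral>y. \<bar>ln (norm (v + y))\<bar> \<partial>sphere3_measure) \<le> (\<integral>y. 2 * ln 3 - ln (norm (v + y)) \<partial>sphere3_measure)"
  proof (rule integral_mono_AE)
    show "AE y in sphere3_measure. \<bar>ln (norm (v + y))\<bar> \<le> 2 * ln 3 - ln (norm (v + y))"
      using AE_sphere3_norm
    proof eventually_elim
      case (elim y)
      have "norm (v + y) \<le> 3" using norm_triangle_ineq[of v y] elim assms by linarith
      then show ?case by (intro abs_ln_le) auto
    qed
  qed (use integrable_sphere3_ln[OF assms(1)] in auto)
  also have "\<dots> = 2 * ln 3 - log_potential (norm v)"
    using assms prob_space by (subst Bochner_Integration.integral_diff)
      (simp_all add: integrable_sphere3_ln integral_sphere3_ln)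
  finally show ?thesis using log_potential_nonneg[of "norm v"] by simp
qed

section \<open>Reduction of the Mahler measure to one zonal integral\<close>

lemma norm_quat_one: "norm quat_one = 1"
  by (simp add: quat_one_def norm_Pair)

text \<open>The exceptional radius 1 occurs on the sphere only for
  \<open>quat_one \<bullet> x = - 1/2\<close>, that is at the single angle \<open>pi/3\<close>,
  which has zonal measure zero.\<close>

lemma AE_sphere3_norm_one_add: "AE x in sphere3_measure. norm (quat_one + x) \<noteq> 1 \<and> norm (quat_one + x) \<le> 2"
proof -
  have "AE \<theta> in zonal_measure. - norm quat_one * cos \<theta> \<noteq> - 1/2"
    using AE_zonal_measure AE_zonal_measure_neq[of "pi/3"]
  proof eventually_elim
    case (elim \<theta>)
    then have "cos \<theta> \<noteq> cos (pi/3)" using cos_inj_pi[of \<theta> "pi/3"] by auto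
    then show ?case by (simp add: norm_quat_one cos_60)
  qed
  then have "AE s in distr zonal_measure borel (\<lambda>\<theta>. - norm quat_one * cos \<theta>). s \<noteq> - 1/2"
    by (subst AE_distr_iff) auto
  then have "AE x in sphere3_measure. quat_one \<bullet> x \<noteq> - 1/2"
    unfolding distr_sphere3_inner[symmetric] by (subst (asm) AE_distr_iff) auto
  then show ?thesis
    using AE_sphere3_norm
  proof eventually_elim
    case (elim x)
    then show ?case using norm_triangle_ineq[of quat_one x]
      by (auto simp: norm_add_sphere3 norm_quat_one)
  qed
qed

lemma integrable_torus2H_ln:
  "integrable (sphere3_measure \<Otimes>\<^sub>M sphere3_measure) (\<lambda>z. ln (norm (quat_one + fst z + snd z)))"
proof -
  interpret S: prob_space sphere3_measure by (rule prob_space_sphere3_measure)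
  interpret pair_sigma_finite sphere3_measure sphere3_measure ..
  show ?thesis
  proof (rule Fubini_integrable)
    show "(\<lambda>z. ln (norm (quat_one + fst z + snd z))) \<in> borel_measurable (sphere3_measure \<Otimes>\<^sub>M sphere3_measure)"
      by measurable
    show "integrable sphere3_measure (\<lambda>x. \<integral>y. norm (ln (norm (quat_one + fst (x, y) + snd (x, y)))) \<partial>sphere3_measure)"
    proof (rule S.integrable_const_bound[where B="2 * ln 3"])
      show "AE x in sphere3_measure. norm (\<integral>y. norm (ln (norm (quat_one + fst (x, y) + snd (x, y)))) \<partial>sphere3_measure) \<le> 2 * ln 3"
        using AE_sphere3_norm_one_add
        by eventually_elim (use integral_sphere3_abs_ln_le in simp)
    qed measurable
    show "AE x in sphere3_measure. integrable sphere3_measure (\<lambda>y. ln (norm (quat_one + fst (x, y) + snd (x, y))))"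
      using AE_sphere3_norm_one_add
      by eventually_elim (use integrable_sphere3_ln in simp)
  qed
qed

text \<open>Integrating over \<open>y\<close> first leaves a function of
  \<open>norm (quat_one + x)\<close>, which is \<open>sqrt (2 + 2 * (quat_one \<bullet> x))\<close>
  on the sphere and so depends on the angle only.\<close>

lemma mahler_H_one_add:
  "mahler_H (\<lambda>x y. quat_one + x + y) = (\<integral>\<theta>. log_potential (sqrt (2 - 2 * cos \<theta>)) \<partial>zonal_measure)"
proof -
  interpret S: prob_space sphere3_measure by (rule prob_space_sphere3_measure)
  interpret pair_sigma_finite sphere3_measure sphere3_measure ..
  have "mahler_H (\<lambda>x y. quat_one + x + y)
      = (\<integral>x. \<integral>y. ln (norm (quat_one + x + y)) \<partial>sphere3_measure \<partial>sphere3_measure)"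
    unfolding mahler_H_def torus2H_measure_def
    using integral_fst'[OF integrable_torus2H_ln] by simp
  also have "\<dots> = (\<integral>x. log_potential (sqrt (2 + 2 * (quat_one \<bullet> x))) \<partial>sphere3_measure)"
  proof (rule integral_cong_AE)
    show "AE x in sphere3_measure. (\<integral>y. ln (norm (quat_one + x + y)) \<partial>sphere3_measure)
        = log_potential (sqrt (2 + 2 * (quat_one \<bullet> x)))"
      using AE_sphere3_norm_one_add AE_sphere3_norm
      by eventually_elim (simp add: integral_sphere3_ln norm_add_sphere3 norm_quat_one)
  qed measurable
  also have "\<dots> = (\<integral>\<theta>. log_potential (sqrt (2 + 2 * (- norm quat_one * cos \<theta>))) \<partial>zonal_measure)"
    by (rule integral_sphere3_inner[where g="\<lambda>s. log_potential (sqrt (2 + 2 * s))"]) simp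
  finally show ?thesis by (simp add: norm_quat_one)
qed

section \<open>Evaluation of the zonal integral on both sides of \<open>pi/3\<close>\<close>

text \<open>Up to \<open>pi/3\<close> the radius \<open>sqrt (2 - 2 * cos \<theta>)\<close> is at
  most 1, so only the quadratic branch of \<open>log_potential\<close> enters.\<close>

lemma has_integral_log_potential_small:
  "((\<lambda>\<theta>. log_potential (sqrt (2 - 2 * cos \<theta>)) * (sin \<theta>)\<^sup>2) has_integral (pi/12 - sqrt 3 / 8)) {0..pi/3}"
proof -
  let ?A = "\<lambda>\<theta>::real. \<theta> / 4 - sin \<theta> * cos \<theta> / 4 - (sin \<theta>) ^ 3 / 6"
  have "((\<lambda>\<theta>. (1 - cos \<theta>) / 2 * (sin \<theta>)\<^sup>2) has_integral (?A (pi/3) - ?A 0)) {0..pi/3}"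
  proof (rule fundamental_theorem_of_calculus)
    fix \<theta> :: real
    have d: "(?A has_real_derivative (1/4 - (cos \<theta> * cos \<theta> - sin \<theta> * sin \<theta>) / 4 - 3 * (sin \<theta>)\<^sup>2 * cos \<theta> / 6)) (at \<theta> within {0..pi/3})"
      by (auto intro!: derivative_eq_intros simp: power2_eq_square)
    have e: "1/4 - (cos \<theta> * cos \<theta> - sin \<theta> * sin \<theta>) / 4 - 3 * (sin \<theta>)\<^sup>2 * cos \<theta> / 6 = (1 - cos \<theta>) / 2 * (sin \<theta>)\<^sup>2"
    proof -
      have *: "cos \<theta> * cos \<theta> = 1 - sin \<theta> * sin \<theta>" using cos_squared_eq[of \<theta>] by (simp add: power2_eq_square)
      show ?thesis unfolding power2_eq_square * by (simp add: field_simps)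
    qed
    show "(?A has_vector_derivative (1 - cos \<theta>) / 2 * (sin \<theta>)\<^sup>2) (at \<theta> within {0..pi/3})"
      using d unfolding e has_real_derivative_iff_has_vector_derivative .
  qed simp
  moreover have "?A (pi/3) - ?A 0 = pi/12 - sqrt 3 / 8"
    by (simp add: sin_60 cos_60 power3_eq_cube)
  ultimately have "((\<lambda>\<theta>. (1 - cos \<theta>) / 2 * (sin \<theta>)\<^sup>2) has_integral (pi/12 - sqrt 3 / 8)) {0..pi/3}" by (simp only:)
  then show ?thesis
  proof (rule has_integral_eq[rotated])
    fix \<theta> :: real assume \<theta>: "\<theta> \<in> {0..pi/3}"
    have "2 - 2 * cos \<theta> \<le> 1" using half_le_cos[OF \<theta>] by simp
    then show "(1 - cos \<theta>) / 2 * (sin \<theta>)\<^sup>2 = log_potential (sqrt (2 - 2 * cos \<theta>)) * (sin \<theta>)\<^sup>2"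
      by (simp add: log_potential_def field_simps)
  qed
qed

text \<open>Integration by parts removes the factor \<open>cos (2 \<theta>)\<close> that \<open>(sin \<theta>)\<^sup>2\<close> puts in front of the logarithm.\<close>

lemma has_integral_log_potential_large:
  "((\<lambda>\<theta>. log_potential (sqrt (2 - 2 * cos \<theta>)) * (sin \<theta>)\<^sup>2) has_integral
    (3 * sqrt 3 / 8 * L_chi_m3_2 + pi/6 - 7 * sqrt 3 / 32)) {pi/3..pi}"
proof -
  let ?l = "\<lambda>\<theta>::real. ln (2 - 2 * cos \<theta>) / 2"
  \<comment> \<open>The first term integrates the factor \<open>- cos (2 * \<theta>) / 2\<close> of
    \<open>?l\<close>. The others integrate \<open>cos \<theta> * (1 + cos \<theta>) / 4\<close>,
    left over by parts, together with \<open>(1 + cos \<theta>) / 8\<close>.\<close>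
  let ?P = "\<lambda>\<theta>. - (sin \<theta> * cos \<theta> * ?l \<theta> / 2) + 3/8 * sin \<theta> + \<theta> / 4 + sin \<theta> * cos \<theta> / 8"
  let ?p = "\<lambda>\<theta>. ?l \<theta> * (sin \<theta>)\<^sup>2 - ?l \<theta> / 2 + (1 + cos \<theta>) / 8"
  have pos: "1 - cos \<theta> > 0" if "\<theta> \<in> {pi/3..pi}" for \<theta> using cos_le_half[OF that] by simp
  have P: "(?p has_integral (?P pi - ?P (pi/3))) {pi/3..pi}"
  proof (rule fundamental_theorem_of_calculus)
    fix \<theta> :: real assume \<theta>: "\<theta> \<in> {pi/3..pi}"
    define c where "c = cos \<theta>"
    define s where "s = sin \<theta>"
    have c: "1 - c > 0" "2 - 2 * c > 0" using pos[OF \<theta>] by (simp_all add: c_def)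
    have s2: "s * s = (1 - c) * (1 + c)"
      using sin_squared_eq[of \<theta>] by (simp add: c_def s_def power2_eq_square algebra_simps)
    have d: "(?P has_real_derivative (- (((c * c - s * s) * ?l \<theta> + s * c * (s / (2 - 2 * c))) / 2) + 3/8 * c + 1/4 + (c * c - s * s) / 8)) (at \<theta> within {pi/3..pi})"
      using c by (auto intro!: derivative_eq_intros simp: c_def s_def field_simps)
    have e1: "s * c * (s / (2 - 2 * c)) = c * (1 + c) / 2"
    proof -
      have "s * c * (s / (2 - 2 * c)) = c * (s * s) / (2 - 2 * c)" by simp
      also have "\<dots> = c * (1 + c) / 2" unfolding s2 using c by (simp add: divide_simps) (simp add: algebra_simps)
      finally show ?thesis .
    qed
    have e2: "- (((c * c - s * s) * ?l \<theta> + c * (1 + c) / 2) / 2) + 3/8 * c + 1/4 + (c * c - s * s) / 8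
        = ?l \<theta> * (s * s) - ?l \<theta> / 2 + (1 + c) / 8"
      unfolding s2 by (simp add: field_simps)
    show "(?P has_vector_derivative ?p \<theta>) (at \<theta> within {pi/3..pi})"
      using d unfolding e1 e2 unfolding c_def s_def has_real_derivative_iff_has_vector_derivative
      by (simp only: power2_eq_square)
  qed simp
  have "((\<lambda>\<theta>. ?p \<theta> + ?l \<theta> / 2) has_integral
      (?P pi - ?P (pi/3) + 3 * sqrt 3 / 4 * L_chi_m3_2 / 2)) {pi/3..pi}"
    using has_integral_ln_two_minus_two_cos unfolding suminf_sin_third
    by (intro has_integral_add P has_integral_divide)
  \<comment> \<open>No logarithm survives: \<open>sin\<close> vanishes at \<open>pi\<close>, and
    \<open>2 - 2 * cos \<theta>\<close> is 1 at \<open>pi/3\<close>.\<close>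
  moreover have "?P pi - ?P (pi/3) + 3 * sqrt 3 / 4 * L_chi_m3_2 / 2
      = 3 * sqrt 3 / 8 * L_chi_m3_2 + pi/6 - 7 * sqrt 3 / 32"
    by (simp add: sin_60 cos_60)
  ultimately have "((\<lambda>\<theta>. ?p \<theta> + ?l \<theta> / 2) has_integral
      (3 * sqrt 3 / 8 * L_chi_m3_2 + pi/6 - 7 * sqrt 3 / 32)) {pi/3..pi}" by (simp only:)
  then show ?thesis
  proof (rule has_integral_eq[rotated])
    fix \<theta> :: real assume \<theta>: "\<theta> \<in> {pi/3..pi}"
    have c: "1 \<le> 2 - 2 * cos \<theta>" using cos_le_half[OF \<theta>] by simp
    have "log_potential (sqrt (2 - 2 * cos \<theta>)) = ?l \<theta> + 1 / (4 * (2 - 2 * cos \<theta>))"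
    \<comment> \<open>At radius 1 the definition takes the quadratic branch, whose value 1/4 agrees
      with the other formula.\<close>
    proof (cases "2 - 2 * cos \<theta> = 1")
      case True
      then show ?thesis by (simp add: log_potential_def)
    next
      case False
      then show ?thesis using c by (simp add: log_potential_def ln_sqrt)
    qed
    moreover have "1 / (4 * (2 - 2 * cos \<theta>)) * (sin \<theta>)\<^sup>2 = (1 + cos \<theta>) / 8"
    proof -
      have "(sin \<theta>)\<^sup>2 = (1 - cos \<theta>) * (1 + cos \<theta>)"
        by (simp add: sin_squared_eq power2_eq_square algebra_simps)
      then show ?thesis using pos[OF \<theta>] by (simp add: divide_simps)
    qed
    ultimately show "?p \<theta> + ?l \<theta> / 2 = log_potential (sqrt (2 - 2 * cos \<theta>)) * (sin \<theta>)\<^sup>2"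
      by (simp add: distrib_right)
  qed
qed

lemma log_potential_le:
  assumes "0 \<le> r" "r \<le> 2"
  shows "\<bar>log_potential r\<bar> \<le> ln 2 + 1"
proof -
  have ln2: "0 \<le> ln (2::real)" by simp
  have "log_potential r \<le> ln 2 + 1"
  proof (cases "r \<le> 1")
    case True
    then have "r\<^sup>2 \<le> 1" using assms by (simp add: abs_square_le_1)
    then have "r\<^sup>2 / 4 \<le> ln 2 + 1" using ln2 by linarith
    then show ?thesis using True by (simp add: log_potential_def)
  next
    case False
    then have "1 \<le> r\<^sup>2" by (intro one_le_power) simp
    then have "1 / (4 * r\<^sup>2) \<le> 1" by (subst divide_le_eq_1_pos) linarith+
    moreover have "ln r \<le> ln 2" using False assms by simp
    ultimately have "ln r + 1 / (4 * r\<^sup>2) \<le> ln 2 + 1" by linarith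
    then show ?thesis using False by (simp add: log_potential_def)
  qed
  then show ?thesis using log_potential_nonneg[OF assms(1)] by simp
qed

theorem theorem1p5:
  shows "integrable torus2H_measure (\<lambda>z. ln (norm (quat_one + fst z + snd z)))
    \<and> mahler_H (\<lambda>x y. quat_one + x + y)
      = 1/2 - 11 * sqrt 3 / (16 * pi) + 3 * sqrt 3 / (4 * pi) * L_chi_m3_2"
proof
  show "integrable torus2H_measure (\<lambda>z. ln (norm (quat_one + fst z + snd z)))"
    unfolding torus2H_measure_def by (rule integrable_torus2H_ln)
  let ?f = "\<lambda>\<theta>. log_potential (sqrt (2 - 2 * cos \<theta>))"
  \<comment> \<open>After multiplication by \<open>2 / pi\<close>, the sum
    \<open>pi/12 + pi/6\<close> yields 1/2, and \<open>1/8 + 7/32 = 11/32\<close> yields the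
    coefficient 11/16.\<close>
  let ?I = "pi/12 - sqrt 3 / 8 + (3 * sqrt 3 / 8 * L_chi_m3_2 + pi/6 - 7 * sqrt 3 / 32)"
  have "integrable zonal_measure ?f"
  proof (rule integrable_zonal_measure_bounded)
    fix \<theta> :: real
    have "2 - 2 * cos \<theta> \<le> 2\<^sup>2" using cos_ge_minus_one[of \<theta>] unfolding power2_eq_square by linarith
    then have "sqrt (2 - 2 * cos \<theta>) \<le> 2" by (intro real_le_lsqrt) auto
    then show "\<bar>?f \<theta>\<bar> \<le> ln 2 + 1" by (intro log_potential_le) auto
  qed measurable
  moreover have "((\<lambda>\<theta>. ?f \<theta> * (sin \<theta>)\<^sup>2) has_integral ?I) {0..pi}"
    by (rule has_integral_combine[OF _ _ has_integral_log_potential_small has_integral_log_potential_large])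
       simp_all
  ultimately have "mahler_H (\<lambda>x y. quat_one + x + y) = 2 / pi * ?I"
    unfolding mahler_H_one_add by (intro integral_zonal_measure) measurable
  also have "\<dots> = 1/2 - 11 * sqrt 3 / (16 * pi) + 3 * sqrt 3 / (4 * pi) * L_chi_m3_2"
    by (simp add: field_simps)
  finally show "mahler_H (\<lambda>x y. quat_one + x + y)
      = 1/2 - 11 * sqrt 3 / (16 * pi) + 3 * sqrt 3 / (4 * pi) * L_chi_m3_2" .
qed

end
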